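(* If a solution of the inverse mean curvature flow in $\mathbb{R}^2\cong\mathbb{C}$ moves by scaling and rotation, then there exist $c,d$ such that it can be expressed as $e^{(d+ci)t}x(s)$ for some initial curve $x(s)$ satisfying $$c\langle x,T\rangle-d\langle x,N\rangle=\frac{1}{k}.$$
   Context: $\mathbb{R}^2$ is identified with $\mathbb{C}$, so that rotation is multiplication by a complex number of absolute value one and scaling is multiplication by a positive real number; $\langle\cdot,\cdot\rangle$ is the Euclidean inner product. The curve $x:\mathbb{R}\to\mathbb{R}^2\cong\mathbb{C}$ is parametrized by arc length $s$, $T$ is its unit tangent vector, $N$ is the unit normal vector obtained by rotating $T$ counter-clockwise by $\frac{\pi}{2}$, and $k=\langle \frac{dT}{ds},N\rangle=-H$ is the signed curvature with respect to $N$, where $H$ is the mean curvature. The inverse mean curvature flow is $\frac{dx}{dt}=\frac1H N$, used here in the form $\langle\partial_t x(s,t),N(s,t)\rangle=-\frac{1}{k(s,t)}$, where $N(s,t)$ and $k(s,t)$ are the unit normal and signed curvature of the curve at time $t$. A solution moves by scaling and rotation if it has the form $x(s,t)=\mathbf{S}(t)e^{i\mathbf{R}(t)}x(s)$ with $\mathbf{S}:\mathbb{R}\to\mathbb{R}^+$, $\mathbf{R}:\mathbb{R}\to\mathbb{R}$, $\mathbf{S}(0)=1$, $\mathbf{R}(0)=0$.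
   Formalization: The printed equation has a sign error under the stated conventions (N = iT); it is proved as -c<x,T> - d<x,N> = 1/k. "Can be expressed as" means up to orientation-preserving reparametrization at each time, since pointwise equality fails for circles rotating at variable speed. *)

theory Defs
  imports "HOL-Analysis.Analysis"
begin

text \<open>
  The plane is \<^typ>\<open>complex\<close>, whose \<^const>\<open>inner\<close> is the Euclidean inner product.
  The time slices of a flow that starts from an arc-length parametrized curve are in general not
  parametrized by arc length any more, so tangent, normal and curvature are defined for arbitrary
  regular parametrizations.
\<close>

definition unit_tangent :: "(real \<Rightarrow> complex) \<Rightarrow> real \<Rightarrow> complex" where
  "unit_tangent \<gamma> s =
     vector_derivative \<gamma> (at s) /\<^sub>R norm (vector_derivative \<gamma> (at s))"

definition unit_normal :: "(real \<Rightarrow> complex) \<Rightarrow> real \<Rightarrow> complex" where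
  "unit_normal \<gamma> s = \<i> * unit_tangent \<gamma> s"

text \<open>
  The division by the speed turns the derivative of the unit tangent with respect to the
  parameter into its derivative with respect to arc length.
\<close>

definition curvature :: "(real \<Rightarrow> complex) \<Rightarrow> real \<Rightarrow> real" where
  "curvature \<gamma> s =
     inner (vector_derivative (unit_tangent \<gamma>) (at s) /\<^sub>R norm (vector_derivative \<gamma> (at s)))
       (unit_normal \<gamma> s)"

text \<open>The least regularity for which the three notions above are meaningful.\<close>

definition regular_curve :: "(real \<Rightarrow> complex) \<Rightarrow> bool" where
  "regular_curve \<gamma> \<longleftrightarrow>
     (\<forall>s. \<gamma> differentiable (at s) \<and> vector_derivative \<gamma> (at s) \<noteq> 0 \<and>
          unit_tangent \<gamma> differentiable (at s))"

definition arc_length_parametrized :: "(real \<Rightarrow> complex) \<Rightarrow> bool" where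
  "arc_length_parametrized \<gamma> \<longleftrightarrow>
     (\<forall>s. \<gamma> differentiable (at s) \<and> norm (vector_derivative \<gamma> (at s)) = 1)"

text \<open>
  A family of curves \<open>x s t\<close> has curve parameter \<open>s\<close> and time \<open>t\<close>.  As \<open>1 / 0 = 0\<close> in HOL,
  nonvanishing of the curvature has to be demanded explicitly.
\<close>

definition imcf_solution :: "(real \<Rightarrow> real \<Rightarrow> complex) \<Rightarrow> bool" where
  "imcf_solution x \<longleftrightarrow>
     (\<forall>t. regular_curve (\<lambda>s. x s t)) \<and>
     (\<forall>s t. x s differentiable (at t) \<and>
            curvature (\<lambda>s. x s t) s \<noteq> 0 \<and>
            inner (vector_derivative (x s) (at t)) (unit_normal (\<lambda>s. x s t) s)
              = - 1 / curvature (\<lambda>s. x s t) s)"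

definition moves_by_scaling_and_rotation ::
    "(real \<Rightarrow> real \<Rightarrow> complex) \<Rightarrow> (real \<Rightarrow> complex) \<Rightarrow> bool" where
  "moves_by_scaling_and_rotation x x0 \<longleftrightarrow>
     (\<exists>(S :: real \<Rightarrow> real) (R :: real \<Rightarrow> real).
        (\<forall>t. S t > 0) \<and> S 0 = 1 \<and> R 0 = 0 \<and>
        (\<forall>s t. x s t = of_real (S t) * exp (\<i> * of_real (R t)) * x0 s))"

text \<open>
  The flow equation only prescribes the normal velocity, so it determines parametrized curves only
  up to orientation-preserving reparametrization.
\<close>

definition same_curve :: "(real \<Rightarrow> complex) \<Rightarrow> (real \<Rightarrow> complex) \<Rightarrow> bool" where
  "same_curve \<gamma> \<eta> \<longleftrightarrow>
     (\<exists>\<phi> :: real \<Rightarrow> real. bij \<phi> \<and>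
        (\<forall>s. \<phi> differentiable (at s) \<and> deriv \<phi> s > 0) \<and>
        (\<forall>s. \<gamma> (\<phi> s) = \<eta> s))"

end

theory Submission
  imports Defs
begin

text \<open>
  Write the flow as \<open>x s t = A t * x0 s\<close> with \<open>A t = S t * exp (\<i> * R t)\<close>, and let \<open>w = A' / A\<close> be
  the logarithmic velocity.  A similarity with factor \<open>a\<close> rotates the unit normal by \<open>a / \<bar>a\<bar>\<close> and
  divides the curvature by \<open>\<bar>a\<bar>\<close>.  The factor \<open>A t\<close> therefore cancels from the flow equation at
  time \<open>t\<close>, and what remains is a condition on the initial curve:
  \<open>\<langle>w t * x0, N\<rangle> = - 1 / k\<close> (lemma \<open>imcf_logarithmic_velocity\<close>).  For a constant
  \<open>w = d + c * \<i>\<close> its left-hand side is \<open>c * \<langle>x0, T\<rangle> + d * \<langle>x0, N\<rangle>\<close>, and \<open>A\<close> solves the linear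
  equation \<open>A' = w * A\<close>, so that \<open>A t = exp (w * t)\<close>.

  The logarithmic velocity need not be constant, since a curve that is invariant under a
  one-parameter group of similarities can be moved along itself at an arbitrary speed.  But if it
  takes two different values, their difference \<open>v\<close> satisfies \<open>\<langle>v * x0, N\<rangle> = 0\<close>: the initial curve is
  tangent to the linear vector field \<open>z \<mapsto> v * z\<close>.  Its orbits are rays from the origin, logarithmic
  spirals and circles about the origin.  Rays have zero curvature, and spirals have finite length
  towards the origin, so that only the circles are images of curves with nonvanishing curvature
  which are parametrized by arc length on the whole line
  (lemma \<open>circle_if_tangent_to_linear_field\<close>).  For a circle the flow equation determines the
  scaling, \<open>S t = exp t\<close>, while the rotation is arbitrary and amounts to a shift of the arc-length
  parameter.  So \<open>c = 0\<close> and \<open>d = 1\<close> will do, and this is the only place where a nontrivial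
  reparametrization is needed.
\<close>

section \<open>Linear differential equations and plane geometry\<close>

lemma linear_ode_solution:
  fixes y :: "real \<Rightarrow> 'a :: {real_normed_field, banach}"
  assumes "\<And>t. (y has_vector_derivative a * y t) (at t)"
  shows "y t = exp (t *\<^sub>R a) * y 0"
proof -
  define z where "z t = exp (t *\<^sub>R (- a)) * y t" for t
  have "(z has_vector_derivative 0) (at t)" for t
  proof -
    have "(z has_vector_derivative
        exp (t *\<^sub>R (- a)) * (a * y t) + (exp (t *\<^sub>R (- a)) * (- a)) * y t) (at t)"
      unfolding z_def
      by (intro has_vector_derivative_mult assms exp_scaleR_has_vector_derivative_right)
    then show ?thesis by (simp add: algebra_simps)
  qed
  then obtain b where b: "\<And>t. z t = b"
    using has_vector_derivative_zero_constant[of UNIV z] by auto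
  have "exp (t *\<^sub>R a) * z t = y t"
    by (simp add: z_def exp_minus)
  moreover have "z t = y 0"
    using b[of t] b[of 0] by (simp add: z_def)
  ultimately show ?thesis by simp
qed

lemma inner_mult_left_self: "inner (z * a) a = Re z * (norm a)\<^sup>2" for z a :: complex
  unfolding cmod_power2 by (simp add: inner_complex_def algebra_simps power2_eq_square)

lemma inner_mult_left_rotated: "inner (z * a) (\<i> * a) = Im z * (norm a)\<^sup>2" for z a :: complex
  unfolding cmod_power2 by (simp add: inner_complex_def algebra_simps power2_eq_square)

lemma inner_mult_left_unit_frame:
  "inner (z * a) (\<i> * b) = Re z * inner a (\<i> * b) + Im z * inner a b" for z a b :: complex
  by (simp add: inner_complex_def algebra_simps)

lemma inner_mult_both: "inner (z * a) (z * b) = (norm z)\<^sup>2 * inner a b" for z a b :: complex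
  unfolding cmod_power2 by (simp add: inner_complex_def algebra_simps power2_eq_square)

text \<open>Expansion in the orthonormal frame consisting of \<open>a\<close> and \<open>\<i> * a\<close>.\<close>

lemma unit_frame_expansion:
  fixes a z :: complex
  assumes "norm a = 1"
  shows "z = inner z a *\<^sub>R a + inner z (\<i> * a) *\<^sub>R (\<i> * a)"
proof -
  have "z = (z * cnj a) * a"
    using assms by (simp add: complex_norm_square[symmetric] mult.assoc mult.commute[of "cnj a"])
  moreover have "z * cnj a = of_real (inner z a) + \<i> * of_real (inner z (\<i> * a))"
    by (simp add: complex_eq_iff inner_complex_def)
  ultimately show ?thesis
    by (metis (no_types, lifting) distrib_right mult.commute mult.left_commute scaleR_conv_of_real)
qed

section \<open>Regular plane curves\<close>

lemma norm_unit_tangent: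
  "regular_curve \<gamma> \<Longrightarrow> norm (unit_tangent \<gamma> s) = 1"
  by (simp add: regular_curve_def unit_tangent_def)

lemma regular_curve_has_vector_derivative:
  assumes "regular_curve \<gamma>"
  shows "(\<gamma> has_vector_derivative norm (vector_derivative \<gamma> (at s)) *\<^sub>R unit_tangent \<gamma> s) (at s)"
  using assms vector_derivative_works[of \<gamma> "at s"]
  by (simp add: regular_curve_def unit_tangent_def)

text \<open>
  The Frenet equation.  The unit tangent has constant norm, so its derivative is orthogonal to it
  and hence a multiple of the normal.
\<close>

lemma frenet_unit_tangent:
  assumes "regular_curve \<gamma>"
  shows "(unit_tangent \<gamma> has_vector_derivative
    (norm (vector_derivative \<gamma> (at s)) * curvature \<gamma> s) *\<^sub>R unit_normal \<gamma> s) (at s)"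
proof -
  let ?T = "unit_tangent \<gamma>"
  define D where "D = vector_derivative ?T (at s)"
  have D: "(?T has_vector_derivative D) (at s)"
    using assms unfolding D_def by (simp add: regular_curve_def vector_derivative_works[symmetric])
  have n: "norm (?T r) = 1" for r
    using assms by (rule norm_unit_tangent)
  have "((\<lambda>r. inner (?T r) (?T r)) has_vector_derivative inner (?T s) D + inner D (?T s)) (at s)"
    using bounded_bilinear.has_vector_derivative[OF bounded_bilinear_inner D D] .
  moreover have "(\<lambda>r. inner (?T r) (?T r)) = (\<lambda>_. 1)"
    using n by (simp add: power2_norm_eq_inner[symmetric])
  ultimately have "inner (?T s) D + inner D (?T s) = 0"
    using has_vector_derivative_const vector_derivative_unique_at by metis
  then have "inner D (?T s) = 0"
    by (simp add: inner_commute)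
  then have "D = inner D (unit_normal \<gamma> s) *\<^sub>R unit_normal \<gamma> s"
    using unit_frame_expansion[OF n, of D s] by (simp add: unit_normal_def)
  moreover have "norm (vector_derivative \<gamma> (at s)) * curvature \<gamma> s = inner D (unit_normal \<gamma> s)"
    using assms by (simp add: curvature_def D_def regular_curve_def)
  ultimately show ?thesis
    using D by simp
qed

lemma vector_derivative_cmult:
  fixes \<gamma> :: "real \<Rightarrow> complex"
  assumes "\<gamma> differentiable (at s)"
  shows "vector_derivative (\<lambda>s. a * \<gamma> s) (at s) = a * vector_derivative \<gamma> (at s)"
  using assms by (intro vector_derivative_at has_vector_derivative_mult_right)
    (simp add: vector_derivative_works[symmetric])

lemma unit_tangent_similarity:
  assumes "\<gamma> differentiable (at s)"
  shows "unit_tangent (\<lambda>s. a * \<gamma> s) s = sgn a * unit_tangent \<gamma> s"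
  using assms
  by (simp add: unit_tangent_def vector_derivative_cmult sgn_div_norm norm_mult)

lemma unit_normal_similarity:
  assumes "\<gamma> differentiable (at s)"
  shows "unit_normal (\<lambda>s. a * \<gamma> s) s = sgn a * unit_normal \<gamma> s"
  using assms by (simp add: unit_normal_def unit_tangent_similarity)

lemma curvature_similarity:
  assumes "regular_curve \<gamma>" and "a \<noteq> 0"
  shows "curvature (\<lambda>s. a * \<gamma> s) s = curvature \<gamma> s / norm a"
proof -
  have d: "\<gamma> differentiable (at r)" "unit_tangent \<gamma> differentiable (at r)" for r
    using assms by (auto simp: regular_curve_def)
  have "unit_tangent (\<lambda>s. a * \<gamma> s) = (\<lambda>s. sgn a * unit_tangent \<gamma> s)"
    using d by (simp add: unit_tangent_similarity fun_eq_iff)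
  then show ?thesis
    using assms d
    by (simp add: curvature_def unit_normal_similarity vector_derivative_cmult norm_mult
        inner_mult_both norm_sgn field_simps)
qed

text \<open>
  The tangential component \<open>l\<close> of the field \<open>v * \<gamma>\<close> along the curve has derivative \<open>Re v\<close>, and
  differentiating the vanishing normal component yields \<open>l * k = Im v\<close>.  If \<open>Im v = 0\<close>, then
  \<open>l = 0\<close> because \<open>k\<close> has no zero, and therefore also \<open>Re v = 0\<close>.  So \<open>Im v \<noteq> 0\<close> and the affine
  function \<open>l\<close> has no zero on the whole line, which is only possible if it is constant.  For the
  spirals, its zero is the arc length at which the curve would run into the origin.
\<close>

lemma circle_if_tangent_to_linear_field:
  assumes reg: "regular_curve \<gamma>" and arc: "arc_length_parametrized \<gamma>"
    and k: "\<And>s. curvature \<gamma> s \<noteq> 0"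
    and "v \<noteq> 0" and tangential: "\<And>s. inner (v * \<gamma> s) (unit_normal \<gamma> s) = 0"
  obtains \<kappa> where "\<And>s. curvature \<gamma> s = \<kappa>" and "\<And>s. unit_tangent \<gamma> s = \<i> * of_real \<kappa> * \<gamma> s"
proof -
  let ?T = "unit_tangent \<gamma>" and ?N = "unit_normal \<gamma>" and ?k = "curvature \<gamma>"
  have n: "norm (?T s) = 1" for s
    using reg by (rule norm_unit_tangent)
  have speed: "norm (vector_derivative \<gamma> (at s)) = 1" for s
    using arc by (simp add: arc_length_parametrized_def)
  have vG: "((\<lambda>s. v * \<gamma> s) has_vector_derivative v * ?T s) (at s)" for s
    using regular_curve_has_vector_derivative[OF reg, of s]
    by (intro has_vector_derivative_mult_right) (simp add: speed)
  have T: "(?T has_vector_derivative ?k s *\<^sub>R ?N s) (at s)" for s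
    using frenet_unit_tangent[OF reg, of s] by (simp add: speed)
  have N: "(?N has_vector_derivative - (?k s *\<^sub>R ?T s)) (at s)" for s
    using has_vector_derivative_mult_right[OF T, of \<i> s]
    by (simp add: unit_normal_def[abs_def] scaleR_conv_of_real algebra_simps)
  define l where "l s = inner (v * \<gamma> s) (?T s)" for s
  have l: "(l has_vector_derivative Re v) (at s)" for s
  proof -
    have "(l has_vector_derivative
        inner (v * \<gamma> s) (?k s *\<^sub>R ?N s) + inner (v * ?T s) (?T s)) (at s)"
      unfolding l_def using bounded_bilinear.has_vector_derivative[OF bounded_bilinear_inner vG T] .
    then show ?thesis
      using n[of s] by (simp add: tangential inner_mult_left_self)
  qed
  have lk: "l s * ?k s = Im v" for s
  proof -
    have "((\<lambda>s. inner (v * \<gamma> s) (?N s)) has_vector_derivative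
        inner (v * \<gamma> s) (- (?k s *\<^sub>R ?T s)) + inner (v * ?T s) (?N s)) (at s)"
      using bounded_bilinear.has_vector_derivative[OF bounded_bilinear_inner vG N] .
    then have "inner (v * \<gamma> s) (- (?k s *\<^sub>R ?T s)) + inner (v * ?T s) (?N s) = 0"
      unfolding tangential using has_vector_derivative_const vector_derivative_unique_at by metis
    then show ?thesis
      using n[of s] by (simp add: l_def unit_normal_def inner_mult_left_rotated mult.commute)
  qed
  have Im: "Im v \<noteq> 0"
  proof
    assume "Im v = 0"
    then have "l = (\<lambda>_. 0)"
      using lk k by (simp add: fun_eq_iff)
    then have "Re v = 0"
      using l[of 0] has_vector_derivative_const vector_derivative_unique_at by metis
    with \<open>Im v = 0\<close> \<open>v \<noteq> 0\<close> show False
      by (simp add: complex_eq_iff)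
  qed
  have affine: "l s = l 0 + Re v * s" for s
  proof -
    have "((\<lambda>s. l s - s * Re v) has_vector_derivative Re v - 1 * Re v) (at s)" for s
      by (intro has_vector_derivative_diff l has_vector_derivative_mult_left has_vector_derivative_id)
    then obtain b where b: "\<And>s. l s - s * Re v = b"
      using has_vector_derivative_zero_constant[of UNIV "\<lambda>s. l s - s * Re v"] by auto
    then show ?thesis
      using b[of s] b[of 0] by (simp add: algebra_simps)
  qed
  have Re: "Re v = 0"
  proof (rule ccontr)
    assume "Re v \<noteq> 0"
    then have "l (- l 0 / Re v) = 0"
      using affine[of "- l 0 / Re v"] by simp
    then show False
      using lk[of "- l 0 / Re v"] Im by simp
  qed
  show thesis
  proof (rule that[of "Im v / l 0"])
    have l0: "l s = l 0" "l 0 \<noteq> 0" for s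
      using affine[of s] Re lk[of 0] Im by auto
    show "?k s = Im v / l 0" for s
      using lk[of s] l0(1)[of s] l0(2) by (simp add: eq_divide_eq mult.commute)
    show "?T s = \<i> * of_real (Im v / l 0) * \<gamma> s" for s
    proof -
      have "v * \<gamma> s = l s *\<^sub>R ?T s"
        using unit_frame_expansion[OF n[of s], of "v * \<gamma> s"] tangential[of s]
        by (simp add: l_def unit_normal_def)
      moreover have "v = \<i> * of_real (Im v)"
        using Re by (simp add: complex_eq_iff)
      ultimately have "\<i> * of_real (Im v) * \<gamma> s = of_real (l 0) * ?T s"
        using l0(1)[of s] by (metis scaleR_conv_of_real)
      then show ?thesis
        using l0(2) by (simp add: field_simps)
    qed
  qed
qed

section \<open>Self-similar solutions\<close>

text \<open>
  The derivative of \<open>A\<close> is read off from the motion of a single point of the curve away from the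
  origin; a regular curve has such a point.  The angle \<open>R\<close> of the rotation, in contrast, may jump
  by multiples of \<open>2 * \<pi>\<close>, so all differentiation has to be done on \<open>A\<close>.
\<close>

lemma imcf_logarithmic_velocity:
  assumes sol: "imcf_solution (\<lambda>s t. A t * \<gamma> s)" and reg: "regular_curve \<gamma>"
    and A: "\<And>t. A t \<noteq> 0"
  obtains w where "\<And>t. (A has_vector_derivative w t * A t) (at t)"
    and "\<And>s t. inner (w t * \<gamma> s) (unit_normal \<gamma> s) = - 1 / curvature \<gamma> s"
proof -
  have "\<exists>p. \<gamma> p \<noteq> 0"
  proof (rule ccontr)
    assume "\<nexists>p. \<gamma> p \<noteq> 0"
    then have "\<gamma> = (\<lambda>_. 0)" by auto
    then show False
      using reg by (simp add: regular_curve_def)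
  qed
  then obtain p where p: "\<gamma> p \<noteq> 0" ..
  define w where "w t = vector_derivative A (at t) / A t" for t
  have dA: "(A has_vector_derivative w t * A t) (at t)" for t
  proof -
    have "(\<lambda>t. A t * \<gamma> p) differentiable (at t)"
      using sol by (simp add: imcf_solution_def)
    then have "((\<lambda>t. (A t * \<gamma> p) * inverse (\<gamma> p)) has_vector_derivative
        vector_derivative (\<lambda>t. A t * \<gamma> p) (at t) * inverse (\<gamma> p)) (at t)"
      by (intro has_vector_derivative_mult_left) (simp add: vector_derivative_works[symmetric])
    then have "A differentiable (at t)"
      using p by (simp add: mult.assoc differentiableI_vector)
    then show ?thesis
      using A[of t] by (simp add: w_def vector_derivative_works[symmetric])
  qed
  have "inner (w t * \<gamma> s) (unit_normal \<gamma> s) = - 1 / curvature \<gamma> s" for s t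
  proof -
    have d: "\<gamma> differentiable (at s)"
      using reg by (simp add: regular_curve_def)
    have "vector_derivative (\<lambda>t. A t * \<gamma> s) (at t) = w t * A t * \<gamma> s"
      by (intro vector_derivative_at has_vector_derivative_mult_left dA)
    also have "\<dots> = of_real (norm (A t)) * (sgn (A t) * (w t * \<gamma> s))"
      using A[of t] by (simp add: sgn_div_norm scaleR_conv_of_real)
    finally have "inner (vector_derivative (\<lambda>t. A t * \<gamma> s) (at t)) (unit_normal (\<lambda>s. A t * \<gamma> s) s)
        = norm (A t) * inner (w t * \<gamma> s) (unit_normal \<gamma> s)"
      using A[of t] d
      by (simp add: unit_normal_similarity scaleR_conv_of_real[symmetric] inner_mult_both norm_sgn)
    moreover have "inner (vector_derivative (\<lambda>t. A t * \<gamma> s) (at t)) (unit_normal (\<lambda>s. A t * \<gamma> s) s)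
        = - 1 / curvature (\<lambda>s. A t * \<gamma> s) s"
      using sol by (simp add: imcf_solution_def)
    ultimately have "norm (A t) * inner (w t * \<gamma> s) (unit_normal \<gamma> s)
        = norm (A t) * (- 1 / curvature \<gamma> s)"
      using reg A[of t] by (simp add: curvature_similarity)
    then show ?thesis
      using A[of t] unfolding mult_cancel_left by simp
  qed
  with dA show thesis by (rule that)
qed

lemma same_curve_refl: "same_curve \<gamma> \<gamma>"
  unfolding same_curve_def by (rule exI[of _ id]) (auto simp: id_def bij_id[unfolded id_def])

lemma same_curve_shift:
  assumes "\<And>s. \<gamma> (s + h) = \<eta> s"
  shows "same_curve \<gamma> \<eta>"
proof -
  have "((\<lambda>s. s + h) has_real_derivative 1) (at s)" for s
    by (auto intro!: derivative_eq_intros)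
  then have "deriv (\<lambda>s. s + h) s = 1" for s
    by (rule DERIV_imp_deriv)
  moreover have "bij (\<lambda>s :: real. s + h)"
    by (rule bij_betw_byWitness[of _ "\<lambda>s. s - h"]) auto
  ultimately show ?thesis
    unfolding same_curve_def using assms by (intro exI[of _ "\<lambda>s. s + h"]) auto
qed

theorem theorem1p1:
  fixes x :: "real \<Rightarrow> real \<Rightarrow> complex" and x0 :: "real \<Rightarrow> complex"
  assumes "imcf_solution x"
    and "arc_length_parametrized x0"
    and "moves_by_scaling_and_rotation x x0"
  shows "\<exists>c d :: real.
           (\<forall>t. same_curve (\<lambda>s. x s t)
                  (\<lambda>s. exp ((of_real d + of_real c * \<i>) * of_real t) * x0 s)) \<and>
           (\<forall>s. curvature x0 s \<noteq> 0 \<and>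
                - c * inner (x0 s) (unit_tangent x0 s) - d * inner (x0 s) (unit_normal x0 s)
                  = 1 / curvature x0 s)"
proof -
  obtain S R :: "real \<Rightarrow> real" where S: "\<And>t. S t > 0" and S0: "S 0 = 1" and R0: "R 0 = 0"
    and x: "\<And>s t. x s t = of_real (S t) * exp (\<i> * of_real (R t)) * x0 s"
    using assms(3) unfolding moves_by_scaling_and_rotation_def by blast
  define A where "A t = of_real (S t) * exp (\<i> * of_real (R t))" for t
  have x_eq: "x = (\<lambda>s t. A t * x0 s)"
    by (simp add: x A_def fun_eq_iff)
  have A0: "A 0 = 1" and norm_A: "norm (A t) = S t" and A: "A t \<noteq> 0" for t
    using S[of t] by (auto simp: A_def S0 R0 norm_mult)
  have sol: "imcf_solution (\<lambda>s t. A t * x0 s)"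
    using assms(1) by (simp add: x_eq)
  \<comment> \<open>The slice at time zero is the initial curve, which therefore inherits the regularity and the
    nonvanishing curvature that a solution has by definition.\<close>
  have reg: "regular_curve x0" and k: "curvature x0 s \<noteq> 0" for s
    using sol A0 unfolding imcf_solution_def by (metis (no_types, lifting) ext mult_1)+
  obtain w where dA: "\<And>t. (A has_vector_derivative w t * A t) (at t)"
    and w: "\<And>s t. inner (w t * x0 s) (unit_normal x0 s) = - 1 / curvature x0 s"
    using imcf_logarithmic_velocity[OF sol reg A] by blast
  show ?thesis
  proof (cases "\<exists>t. w t \<noteq> w 0")
    case False
    then have const: "w t = w 0" for t
      by blast
    have "(A has_vector_derivative w 0 * A t) (at t)" for t
      using dA[of t] const[of t] by simp
    then have "A t = exp (t *\<^sub>R w 0) * A 0" for t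
      by (rule linear_ode_solution)
    then have "(\<lambda>s. x s t) =
        (\<lambda>s. exp ((of_real (Re (w 0)) + of_real (Im (w 0)) * \<i>) * of_real t) * x0 s)" for t
      by (simp add: x_eq A0 scaleR_conv_of_real complex_eq[symmetric] mult.commute)
    moreover have "- Im (w 0) * inner (x0 s) (unit_tangent x0 s)
        - Re (w 0) * inner (x0 s) (unit_normal x0 s) = 1 / curvature x0 s" for s
      using w[of 0 s] by (simp add: unit_normal_def inner_mult_left_unit_frame)
    ultimately show ?thesis
      using k same_curve_refl by metis
  next
    case True
    then obtain t1 where "w t1 - w 0 \<noteq> 0"
      by auto
    moreover have "inner ((w t1 - w 0) * x0 s) (unit_normal x0 s) = 0" for s
      by (simp add: left_diff_distrib inner_diff_left w)
    ultimately obtain \<kappa> where \<kappa>: "\<And>s. curvature x0 s = \<kappa>"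
      and T: "\<And>s. unit_tangent x0 s = \<i> * of_real \<kappa> * x0 s"
      using circle_if_tangent_to_linear_field[OF reg assms(2) k] by blast
    have "\<kappa> \<noteq> 0"
      using k \<kappa> by metis
    have N: "unit_normal x0 s = - (\<kappa> *\<^sub>R x0 s)" for s
      by (simp add: unit_normal_def T scaleR_conv_of_real mult.assoc[symmetric])
    have radius: "\<kappa>\<^sup>2 * (norm (x0 s))\<^sup>2 = 1" for s
      using norm_unit_tangent[OF reg, of s]
      by (metis T norm_mult norm_ii norm_of_real mult_1 power2_abs power_mult_distrib power_one)
    have "Re (w t) = 1" for t
    proof -
      have "\<kappa> * (Re (w t) * (norm (x0 0))\<^sup>2) = 1 / \<kappa>"
        using w[of t 0] by (simp add: N \<kappa> inner_mult_left_self)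
      then have "Re (w t) * (\<kappa>\<^sup>2 * (norm (x0 0))\<^sup>2) = 1"
        using \<open>\<kappa> \<noteq> 0\<close> by (simp add: field_simps power2_eq_square)
      then show ?thesis
        by (simp add: radius)
    qed
    \<comment> \<open>The squared modulus of \<open>A\<close> satisfies a linear equation involving only the real part of \<open>w\<close>.\<close>
    have "((\<lambda>t. (S t)\<^sup>2) has_vector_derivative 2 * (S t)\<^sup>2) (at t)" for t
    proof -
      have "((\<lambda>t. inner (A t) (A t)) has_vector_derivative
          inner (A t) (w t * A t) + inner (w t * A t) (A t)) (at t)"
        using bounded_bilinear.has_vector_derivative[OF bounded_bilinear_inner dA dA] .
      moreover have "inner (A t) (w t * A t) = (S t)\<^sup>2"
        using inner_mult_left_self[of "w t" "A t"] \<open>Re (w t) = 1\<close>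
        by (simp add: inner_commute norm_A)
      ultimately show ?thesis
        by (simp add: inner_commute power2_norm_eq_inner[symmetric] norm_A)
    qed
    then have "(S t)\<^sup>2 = exp (t *\<^sub>R 2) * (S 0)\<^sup>2" for t
      by (rule linear_ode_solution)
    then have "(S t)\<^sup>2 = (exp t)\<^sup>2" for t
      by (simp add: S0 exp_double[symmetric] mult.commute)
    then have S_exp: "S t = exp t" for t
      using S[of t] by (metis exp_ge_zero less_imp_le power2_eq_imp_eq)
    have "(x0 has_vector_derivative \<i> * of_real \<kappa> * x0 s) (at s)" for s
      using regular_curve_has_vector_derivative[OF reg, of s] assms(2)
      by (simp add: arc_length_parametrized_def T)
    then have x0: "x0 s = exp (s *\<^sub>R (\<i> * of_real \<kappa>)) * x0 0" for s
      by (rule linear_ode_solution)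
    have "same_curve (\<lambda>s. x s t) (\<lambda>s. exp ((of_real 1 + of_real 0 * \<i>) * of_real t) * x0 s)" for t
    proof (rule same_curve_shift)
      fix s
      \<comment> \<open>The shift undoes the rotation, as \<open>\<kappa>\<close> is the angular speed of the circle.\<close>
      have "exp (\<i> * of_real (R t)) * exp ((s + - R t / \<kappa>) *\<^sub>R (\<i> * of_real \<kappa>))
          = exp (s *\<^sub>R (\<i> * of_real \<kappa>))"
        using \<open>\<kappa> \<noteq> 0\<close>
        by (simp add: exp_add[symmetric] scaleR_conv_of_real algebra_simps)
      then have "exp (\<i> * of_real (R t)) * x0 (s + - R t / \<kappa>) = x0 s"
        using x0[of s] x0[of "s + - R t / \<kappa>"] by (metis mult.assoc)
      then show "x (s + - R t / \<kappa>) t = exp ((of_real 1 + of_real 0 * \<i>) * of_real t) * x0 s"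
        by (simp add: x S_exp mult.assoc exp_of_real)
    qed
    moreover have "- 0 * inner (x0 s) (unit_tangent x0 s) - 1 * inner (x0 s) (unit_normal x0 s)
        = 1 / curvature x0 s" for s
      using radius[of s] \<open>\<kappa> \<noteq> 0\<close>
      by (simp add: N \<kappa> power2_norm_eq_inner[symmetric] field_simps power2_eq_square)
    ultimately show ?thesis
      using k by blast
  qed
qed

end
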